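(* With $p$ running over the primes, $$\lim_{p\to\infty}\frac{|T_p^p|}{p^{p^p}}=\frac1e .$$
   Context: For a prime power $q$ and a natural number $m\ge1$, a map $f:\mathbb{F}_{q^m}\to\mathbb{F}_{q^m}$ is called subfield preserving if $f(\mathbb{F}_q)\subseteq\mathbb{F}_q$ and, for all positive divisors $d,s$ of $m$, $f(\mathbb{F}_{q^d}\setminus\mathbb{F}_{q^s})\subseteq\mathbb{F}_{q^d}\setminus\mathbb{F}_{q^s}$. $T_q^m$ denotes the set of subfield preserving maps $f:\mathbb{F}_{q^m}\to\mathbb{F}_{q^m}$ whose polynomial representation (the unique polynomial of degree less than $q^m$ inducing $f$) has coefficients in $\mathbb{F}_q$. $T_p^p$ is the case $q=m=p$ with $p$ prime. *)

theory Defs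
  imports Complex_Main "HOL-Computational_Algebra.Primes" "HOL-Algebra.Polynomials"
begin

text \<open>
  \<open>R\<close> plays the role of the field with \<open>q ^ m\<close> elements, and \<open>subfield_of_order R (q ^ d)\<close>, for
  \<open>d\<close> dividing \<open>m\<close>, is the copy of the field with \<open>q ^ d\<close> elements inside it.
\<close>

definition subfield_of_order :: "('a, 'b) ring_scheme \<Rightarrow> nat \<Rightarrow> 'a set" where
  "subfield_of_order R n = (THE L. subfield L R \<and> card L = n)"

definition subfield_preserving ::
    "('a, 'b) ring_scheme \<Rightarrow> nat \<Rightarrow> nat \<Rightarrow> ('a \<Rightarrow> 'a) \<Rightarrow> bool" where
  "subfield_preserving R q m f \<longleftrightarrow>
     f ` subfield_of_order R q \<subseteq> subfield_of_order R q \<and>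
     (\<forall>d s. 0 < d \<and> d dvd m \<and> 0 < s \<and> s dvd m \<longrightarrow>
        f ` (subfield_of_order R (q ^ d) - subfield_of_order R (q ^ s))
          \<subseteq> subfield_of_order R (q ^ d) - subfield_of_order R (q ^ s))"

text \<open>
  Polynomials are the coefficient lists (leading coefficient first, zero polynomial \<open>[]\<close>) of
  \<open>HOL-Algebra.Polynomials\<close>.  There \<open>degree [] = 0\<close>, which is harmless in the bound below since
  \<open>order R > 0\<close>.
\<close>

definition polynomial_representation :: "('a, 'b) ring_scheme \<Rightarrow> ('a \<Rightarrow> 'a) \<Rightarrow> 'a list" where
  "polynomial_representation R f =
     (THE P. P \<in> carrier (univ_poly R (carrier R)) \<and> degree P < order R \<and>
             (\<forall>x\<in>carrier R. ring.eval R P x = f x))"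

text \<open>
  Maps on \<open>carrier R\<close> are taken to be extensional, so that each is counted exactly once.
\<close>

definition T :: "('a, 'b) ring_scheme \<Rightarrow> nat \<Rightarrow> nat \<Rightarrow> ('a \<Rightarrow> 'a) set" where
  "T R q m = {f \<in> carrier R \<rightarrow>\<^sub>E carrier R.
     subfield_preserving R q m f \<and>
     set (polynomial_representation R f) \<subseteq> subfield_of_order R q}"

end

theory Submission
  imports Defs "HOL-Number_Theory.Cong" "HOL-Algebra.Multiplicative_Group"
    "HOL-Algebra.Polynomial_Divisibility"
begin

text \<open>
  By uniqueness of interpolation, the polynomial representation of \<open>f\<close> has coefficients in the
  prime field iff \<open>f\<close> commutes with the Frobenius map \<open>x \<mapsto> x ^ p\<close>.  The \<open>p\<close>-th iterate of Frobenius
  is the identity and its fixed points are the \<open>p\<close> elements of the prime field, so, \<open>p\<close> being prime,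
  all other orbits have exactly \<open>p\<close> elements.  A subfield preserving \<open>f\<close> thus amounts to an arbitrary
  self-map of the prime field together with an arbitrary choice of a moved point for each of the
  \<open>p ^ (p - 1) - 1\<close> moved orbits.  The count
  \<open>p ^ p * (p ^ p - p) ^ (p ^ (p - 1) - 1)\<close> divided by \<open>p ^ (p ^ p)\<close> is \<open>(1 - 1 / n) ^ (n - 1)\<close>
  with \<open>n = p ^ (p - 1)\<close>.
\<close>

section \<open>Maps commuting with a permutation of prime order\<close>

lemma funpow_in_set:
  assumes "\<sigma> \<in> C \<rightarrow> C" "x \<in> C"
  shows "(\<sigma> ^^ n) x \<in> C"
  using assms by (induction n) auto

lemma funpow_fixed: "\<sigma> x = x \<Longrightarrow> (\<sigma> ^^ n) x = x"
  by (induction n) auto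

text \<open>With \<open>a\<close> inverse to \<open>k\<close> modulo \<open>p\<close>, the iterate
  \<open>\<sigma> ^^ (k * a)\<close> fixes \<open>x\<close> and also acts on \<open>x\<close> as
  \<open>\<sigma>\<close> does.\<close>

lemma fixed_if_coprime_period:
  assumes "(\<sigma> ^^ p) x = x" "(\<sigma> ^^ k) x = x" "coprime k p"
  shows "\<sigma> x = x"
proof -
  obtain a where "[k * a = Suc 0] (mod p)"
    using cong_solve_coprime_nat[OF assms(3)] by auto
  then have "(k * a) mod p = 1 mod p"
    by (simp add: cong_def)
  have "((\<sigma> ^^ k) ^^ a) x = x"
    using assms(2) by (rule funpow_fixed)
  then have "x = (\<sigma> ^^ (k * a)) x"
    by (simp add: funpow_mult)
  also have "\<dots> = (\<sigma> ^^ ((k * a) mod p)) x"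
    using funpow_mod_eq[OF assms(1)] by metis
  also have "\<dots> = (\<sigma> ^^ (1 mod p)) x"
    by (simp only: \<open>(k * a) mod p = 1 mod p\<close>)
  also have "\<dots> = (\<sigma> ^^ 1) x"
    using funpow_mod_eq[OF assms(1)] .
  finally show ?thesis by simp
qed

text \<open>A repetition at \<open>i < j\<close> yields the period \<open>p - j + i\<close>, which
  lies strictly between 0 and the prime \<open>p\<close> and so is coprime to it; then
  \<open>x\<close> would be fixed.\<close>

lemma inj_on_funpow_orbit:
  assumes "Factorial_Ring.prime p" "(\<sigma> ^^ p) x = x" "\<sigma> x \<noteq> x"
  shows "inj_on (\<lambda>i. (\<sigma> ^^ i) x) {..<p}"
proof (rule linorder_inj_onI')
  fix i j assume ij: "i \<in> {..<p}" "j \<in> {..<p}" "i < j"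
  show "(\<sigma> ^^ i) x \<noteq> (\<sigma> ^^ j) x"
  proof
    assume eq: "(\<sigma> ^^ i) x = (\<sigma> ^^ j) x"
    \<comment> \<open>\<open>\<sigma>\<close> is not assumed injective, so
      \<open>\<sigma> ^^ (p - j)\<close> is applied to both sides instead of cancelling
      \<open>\<sigma> ^^ i\<close>.\<close>
    have "(\<sigma> ^^ (p - j + i)) x = (\<sigma> ^^ (p - j + j)) x"
      using eq by (simp only: funpow_add o_apply)
    also have "\<dots> = x" using ij assms(2) by simp
    finally have per: "(\<sigma> ^^ (p - j + i)) x = x" .
    have "0 < p - j + i" "p - j + i < p" using ij by auto
    then have "coprime (p - j + i) p"
      using assms(1) prime_imp_coprime nat_dvd_not_less coprime_commute by metis
    then show False
      using fixed_if_coprime_period[OF assms(2) per] assms(3) by blast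
  qed
qed

text \<open>One representative is chosen in each orbit. As no point is fixed, all orbits have
  \<open>p\<close> elements, which makes the coordinates \<open>(i, r)\<close> of a point
  unique.\<close>

lemma transversal_free_orbits:
  assumes "finite M" "\<sigma> \<in> M \<rightarrow> M" "Factorial_Ring.prime p"
    and period: "\<And>x. x \<in> M \<Longrightarrow> (\<sigma> ^^ p) x = x"
    and free: "\<And>x. x \<in> M \<Longrightarrow> \<sigma> x \<noteq> x"
  obtains S where "S \<subseteq> M" "bij_betw (\<lambda>(i, r). (\<sigma> ^^ i) r) ({..<p} \<times> S) M"
proof -
  have "p > 0" using assms(3) prime_gt_0_nat by blast
  define orb where "orb x = (\<lambda>i. (\<sigma> ^^ i) x) ` {..<p}" for x
  \<comment> \<open>The choice depends only on the set \<open>orb x\<close>, so points with equal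
    orbits get the same representative.\<close>
  define rep where "rep x = (SOME y. y \<in> orb x)" for x
  have self: "x \<in> orb x" for x
    using \<open>p > 0\<close> unfolding orb_def by (auto intro!: image_eqI[of _ _ 0])
  have rep: "rep x \<in> orb x" for x
    unfolding rep_def using self by (metis someI)
  have power_in_orb: "(\<sigma> ^^ n) x \<in> orb x" if "x \<in> M" for x n
  proof -
    have "(\<sigma> ^^ n) x = (\<sigma> ^^ (n mod p)) x"
      using funpow_mod_eq[OF period[OF that]] by metis
    then show ?thesis using \<open>p > 0\<close> by (auto simp: orb_def)
  qed
  have orb_subset: "orb y \<subseteq> orb x" if x: "x \<in> M" and y: "y \<in> orb x" for x y
  proof
    fix z assume "z \<in> orb y"
    then obtain i j where "z = (\<sigma> ^^ i) y" "y = (\<sigma> ^^ j) x" using y by (auto simp: orb_def)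
    then have "z = (\<sigma> ^^ (i + j)) x" by (simp add: funpow_add)
    then show "z \<in> orb x" using power_in_orb[OF x] by simp
  qed
  have orb_M: "orb x \<subseteq> M" if "x \<in> M" for x
    using funpow_in_set[OF assms(2) that] by (auto simp: orb_def)
  have orb_sym: "x \<in> orb y" if x: "x \<in> M" and y: "y \<in> orb x" for x y
  proof -
    obtain i where i: "i < p" "y = (\<sigma> ^^ i) x" using y by (auto simp: orb_def)
    have "(\<sigma> ^^ (p - i)) y = (\<sigma> ^^ (p - i + i)) x" by (simp only: i funpow_add o_apply)
    also have "\<dots> = x" using i period[OF x] by simp
    finally show ?thesis using power_in_orb[of y "p - i"] orb_M[OF x] y by auto
  qed
  have orb_eq: "orb y = orb x" if "x \<in> M" "y \<in> orb x" for x y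
    using orb_subset that orb_sym orb_M by (meson subset_antisym subsetD)
  have rep_eq: "rep y = rep x" if "x \<in> M" "y \<in> orb x" for x y
    using orb_eq[OF that] by (simp add: rep_def)
  define S where "S = rep ` M"
  have S_M: "S \<subseteq> M" using rep orb_M by (auto simp: S_def)
  have rep_S: "rep r = r" if "r \<in> S" for r
    using that rep rep_eq unfolding S_def by blast
  have "inj_on (\<lambda>(i, r). (\<sigma> ^^ i) r) ({..<p} \<times> S)"
  proof (rule inj_onI, clarsimp)
    fix i r j s
    assume *: "i < p" "r \<in> S" "j < p" "s \<in> S" "(\<sigma> ^^ i) r = (\<sigma> ^^ j) s"
    have "r = rep ((\<sigma> ^^ i) r)"
      using * S_M rep_S rep_eq power_in_orb by (metis subsetD)
    also have "\<dots> = s"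
      using * S_M rep_S rep_eq power_in_orb by (metis subsetD)
    finally have "r = s" .
    moreover have "i = j"
      using inj_onD[OF inj_on_funpow_orbit[OF assms(3), of \<sigma> r]] * S_M
        \<open>r = s\<close> period free by blast
    ultimately show "i = j \<and> r = s" by simp
  qed
  moreover have "(\<lambda>(i, r). (\<sigma> ^^ i) r) ` ({..<p} \<times> S) = M"
  proof (intro equalityI subsetI)
    fix y assume "y \<in> (\<lambda>(i, r). (\<sigma> ^^ i) r) ` ({..<p} \<times> S)"
    then show "y \<in> M" using S_M funpow_in_set[OF assms(2)] by auto
  next
    fix x assume x: "x \<in> M"
    have "x \<in> orb (rep x)" using orb_sym[OF x rep] .
    then show "x \<in> (\<lambda>(i, r). (\<sigma> ^^ i) r) ` ({..<p} \<times> S)"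
      using x by (force simp: orb_def S_def)
  qed
  ultimately show thesis using that[OF S_M] by (simp add: bij_betw_def)
qed

section \<open>Counting equivariant maps\<close>

locale prime_period =
  fixes C :: "'a set" and \<sigma> :: "'a \<Rightarrow> 'a" and p :: nat
  assumes fin: "finite C" and maps: "\<sigma> \<in> C \<rightarrow> C" and p_prime: "Factorial_Ring.prime p"
    and period: "x \<in> C \<Longrightarrow> (\<sigma> ^^ p) x = x"
begin

definition fixed :: "'a set" where "fixed = {x \<in> C. \<sigma> x = x}"

text \<open>If \<open>\<sigma> x\<close> were fixed, the remaining \<open>p - 1\<close> steps of the
  cycle would not leave it, although they lead back to \<open>x\<close>.\<close>

lemma maps_moved: "\<sigma> \<in> C - fixed \<rightarrow> C - fixed"
proof
  fix x assume x: "x \<in> C - fixed"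
  have "\<sigma> (\<sigma> x) \<noteq> \<sigma> x"
  proof
    assume "\<sigma> (\<sigma> x) = \<sigma> x"
    then have "(\<sigma> ^^ (p - 1)) (\<sigma> x) = \<sigma> x" by (rule funpow_fixed)
    moreover have "(\<sigma> ^^ (p - 1)) (\<sigma> x) = (\<sigma> ^^ (Suc (p - 1))) x"
      by (simp add: funpow_swap1)
    ultimately show False
      using x period[of x] prime_gt_0_nat[OF p_prime] by (simp add: fixed_def)
  qed
  then show "\<sigma> x \<in> C - fixed" using x maps by (auto simp: fixed_def)
qed

lemma transversal_moved:
  obtains S where "S \<subseteq> C - fixed"
    "bij_betw (\<lambda>(i, r). (\<sigma> ^^ i) r) ({..<p} \<times> S) (C - fixed)"
    "card (C - fixed) = p * card S"
proof -
  have "finite (C - fixed)" "\<And>x. x \<in> C - fixed \<Longrightarrow> (\<sigma> ^^ p) x = x"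
    and "\<And>x. x \<in> C - fixed \<Longrightarrow> \<sigma> x \<noteq> x"
    using fin period by (simp_all add: fixed_def)
  with maps_moved p_prime obtain S where S: "S \<subseteq> C - fixed"
    "bij_betw (\<lambda>(i, r). (\<sigma> ^^ i) r) ({..<p} \<times> S) (C - fixed)"
    by (elim transversal_free_orbits)
  have "card (C - fixed) = p * card S"
    using bij_betw_same_card[OF S(2)] by (simp add: card_cartesian_product)
  then show thesis using that S by blast
qed

text \<open>Moved orbits have \<open>p\<close> elements each, so \<open>card C\<close> and
  \<open>card fixed\<close> agree modulo \<open>p\<close>. This later bounds the number of Frobenius
  fixed points from below.\<close>

lemma card_fixed_dvd:
  assumes "p dvd card C"
  shows "p dvd card fixed"
proof -
  have "card C = card (C - fixed) + card fixed"
    using fin by (metis (no_types, lifting) Diff_partition card_Un_disjoint Diff_disjoint fixed_def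
        finite_Diff finite_subset add.commute mem_Collect_eq subsetI)
  moreover have "p dvd card (C - fixed)" by (rule transversal_moved) simp
  ultimately show ?thesis using assms by (simp add: dvd_add_right_iff)
qed

text \<open>When \<open>\<sigma>\<close> is the Frobenius map, commuting with it expresses that the
  coefficients lie in the prime field, and the two image conditions express subfield
  preservation.\<close>

definition equivariant_maps :: "('a \<Rightarrow> 'a) set" where
  "equivariant_maps = {f \<in> C \<rightarrow>\<^sub>E C. (\<forall>x\<in>C. f (\<sigma> x) = \<sigma> (f x)) \<and>
     f ` fixed \<subseteq> fixed \<and> f ` (C - fixed) \<subseteq> C - fixed}"

lemma equivariant_funpow:
  assumes "f \<in> equivariant_maps" "x \<in> C"
  shows "f ((\<sigma> ^^ n) x) = (\<sigma> ^^ n) (f x)"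
proof (induction n)
  case (Suc n)
  then show ?case
    using assms funpow_in_set[OF maps assms(2)] by (simp add: equivariant_maps_def)
qed simp

text \<open>An equivariant map is determined by its values on the fixed points and on one
  representative of each moved orbit, and these can be prescribed freely.\<close>

lemma card_equivariant_maps:
  "card equivariant_maps = card fixed ^ card fixed * card (C - fixed) ^ (card (C - fixed) div p)"
proof -
  have "p > 0" using p_prime prime_gt_0_nat by blast
  obtain S where S: "S \<subseteq> C - fixed"
    "bij_betw (\<lambda>(i, r). (\<sigma> ^^ i) r) ({..<p} \<times> S) (C - fixed)"
    and card_S: "card (C - fixed) = p * card S"
    by (rule transversal_moved)
  \<comment> \<open>\<open>B r\<close> is the range of values allowed at \<open>r\<close>, so that
    the prescriptions on \<open>fixed \<union> S\<close> form a dependent product.\<close>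
  define B where "B r = (if r \<in> fixed then fixed else C - fixed)" for r
  have fixed_C: "fixed \<subseteq> C" by (auto simp: fixed_def)
  have fin': "finite fixed" "finite S" "fixed \<inter> S = {}"
    using fin fixed_C S(1) by (auto intro: finite_subset)
  have funpow_B: "(\<sigma> ^^ i) y \<in> B x" if "y \<in> B x" for i x y
    using that funpow_in_set[OF maps_moved, of y i] funpow_fixed[of \<sigma> y i]
    by (auto simp: B_def fixed_def split: if_splits)
  have B_C: "B x \<subseteq> C" for x using fixed_C by (auto simp: B_def)
  have decomp: "\<exists>i r. i < p \<and> r \<in> fixed \<union> S \<and> x = (\<sigma> ^^ i) r" if "x \<in> C" for x
  proof (cases "x \<in> fixed")
    case True
    then show ?thesis using \<open>p > 0\<close> by (intro exI[of _ 0] exI[of _ x]) auto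
  next
    case False
    then have "x \<in> (\<lambda>(i, r). (\<sigma> ^^ i) r) ` ({..<p} \<times> S)"
      using S(2) that by (simp add: bij_betw_def)
    then show ?thesis by auto
  qed
  have moved: "(\<sigma> ^^ i) r \<notin> fixed" if "r \<in> S" for i r
    using that funpow_in_set[OF maps_moved, of r i] S(1) by auto
  have "bij_betw (\<lambda>f. restrict f (fixed \<union> S)) equivariant_maps (PiE (fixed \<union> S) B)"
  proof (rule bij_betw_imageI)
    show "inj_on (\<lambda>f. restrict f (fixed \<union> S)) equivariant_maps"
    proof (rule inj_onI)
      fix f g assume f: "f \<in> equivariant_maps" and g: "g \<in> equivariant_maps"
        and "restrict f (fixed \<union> S) = restrict g (fixed \<union> S)"
      then have eq: "f r = g r" if "r \<in> fixed \<union> S" for r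
        using that by (metis restrict_apply')
      show "f = g"
      proof (rule PiE_ext[of _ C "\<lambda>_. C"])
        show "f \<in> C \<rightarrow>\<^sub>E C" "g \<in> C \<rightarrow>\<^sub>E C" using f g by (auto simp: equivariant_maps_def)
        fix x assume "x \<in> C"
        then obtain i r where ir: "r \<in> fixed \<union> S" "x = (\<sigma> ^^ i) r" using decomp by blast
        then have "r \<in> C" using fixed_C S(1) by auto
        then show "f x = g x"
          using equivariant_funpow[OF f] equivariant_funpow[OF g] eq ir by simp
      qed
    qed
    show "(\<lambda>f. restrict f (fixed \<union> S)) ` equivariant_maps = PiE (fixed \<union> S) B"
    proof (intro equalityI subsetI)
      fix g assume "g \<in> (\<lambda>f. restrict f (fixed \<union> S)) ` equivariant_maps"
      then obtain f where f: "f \<in> equivariant_maps" "g = restrict f (fixed \<union> S)" by blast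
      have "f x \<in> B x" if "x \<in> C" for x
        using f(1) that by (auto simp: equivariant_maps_def B_def)
      then show "g \<in> PiE (fixed \<union> S) B"
        using S(1) fixed_C unfolding f(2) by (intro restrict_PiE_iff[THEN iffD2]) blast
    next
      fix g assume g: "g \<in> PiE (fixed \<union> S) B"
      have "\<exists>y. \<forall>i r. r \<in> fixed \<union> S \<longrightarrow> x = (\<sigma> ^^ i) r \<longrightarrow> y = (\<sigma> ^^ i) (g r)" if "x \<in> C" for x
      proof -
        obtain i r where ir: "i < p" "r \<in> fixed \<union> S" "x = (\<sigma> ^^ i) r" using decomp \<open>x \<in> C\<close> by blast
        have "(\<sigma> ^^ i) (g r) = (\<sigma> ^^ j) (g s)"
          if js: "s \<in> fixed \<union> S" "x = (\<sigma> ^^ j) s" for j s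
        proof (cases "s \<in> fixed")
          case True
          then have "x = s" using js funpow_fixed[of \<sigma> s j] by (simp add: fixed_def)
          then have "r \<in> fixed" using ir moved True by blast
          then have "x = r" using ir funpow_fixed[of \<sigma> r i] by (simp add: fixed_def)
          have "g r \<in> fixed" using PiE_mem[OF g, of r] \<open>r \<in> fixed\<close> by (simp add: B_def)
          then show ?thesis
            using \<open>x = r\<close> \<open>x = s\<close> funpow_fixed[of \<sigma> "g r"] by (simp add: fixed_def)
        next
          case False
          then have s: "s \<in> S" using js by auto
          have r: "r \<in> S"
            using ir js moved[OF s, of j] funpow_fixed[of \<sigma> r i] by (auto simp: fixed_def)
          have per_s: "(\<sigma> ^^ p) s = s" using period s S(1) by auto
          \<comment> \<open>Uniqueness of coordinates needs an exponent below \<open>p\<close>.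
            Reducing \<open>j\<close> does no harm to the value, since \<open>g s\<close> has period
            \<open>p\<close> as well.\<close>
          have "(\<sigma> ^^ i) r = (\<sigma> ^^ (j mod p)) s"
            using ir js funpow_mod_eq[OF per_s] by metis
          then have "(i, r) = (j mod p, s)"
            using inj_onD[OF bij_betw_imp_inj_on[OF S(2)], of "(i, r)" "(j mod p, s)"] r s ir \<open>p > 0\<close>
            by auto
          moreover have "g s \<in> C" using g js B_C by (auto simp: PiE_iff)
          ultimately show ?thesis using funpow_mod_eq[OF period] by (metis prod.inject)
        qed
        then show ?thesis by blast
      qed
      then obtain f0 where f0: "\<And>x i r. x \<in> C \<Longrightarrow> r \<in> fixed \<union> S \<Longrightarrow> x = (\<sigma> ^^ i) r
          \<Longrightarrow> f0 x = (\<sigma> ^^ i) (g r)"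
        by metis
      define f where "f = restrict f0 C"
      have f: "f ((\<sigma> ^^ i) r) = (\<sigma> ^^ i) (g r)" if "r \<in> fixed \<union> S" for i r
      proof -
        have "r \<in> C" using that fixed_C S(1) by auto
        then show ?thesis using f0 that funpow_in_set[OF maps] by (simp add: f_def)
      qed
      have f_B: "f x \<in> B x" if "x \<in> C" for x
      proof -
        obtain i r where ir: "i < p" "r \<in> fixed \<union> S" "x = (\<sigma> ^^ i) r" using decomp \<open>x \<in> C\<close> by blast
        have "B x = B r" using ir moved funpow_fixed[of \<sigma> r i] by (auto simp: B_def fixed_def)
        moreover have "g r \<in> B r" using g ir by (auto simp: PiE_iff)
        ultimately show ?thesis using f ir funpow_B by simp
      qed
      have "f (\<sigma> x) = \<sigma> (f x)" if "x \<in> C" for x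
      proof -
        obtain i r where ir: "r \<in> fixed \<union> S" "x = (\<sigma> ^^ i) r" using decomp \<open>x \<in> C\<close> by blast
        then show ?thesis using f[OF ir(1), of i] f[OF ir(1), of "Suc i"] by simp
      qed
      moreover have "f \<in> C \<rightarrow>\<^sub>E C" using f_B B_C by (auto simp: f_def)
      moreover have "f x \<in> fixed" if "x \<in> fixed" for x
        using f_B[of x] that fixed_C by (auto simp: B_def)
      moreover have "f x \<in> C - fixed" if "x \<in> C - fixed" for x
        using f_B[of x] that by (simp add: B_def)
      ultimately have "f \<in> equivariant_maps" unfolding equivariant_maps_def by blast
      moreover have "g = restrict f (fixed \<union> S)"
        using f[where i = 0] g by (intro ext) (auto simp: PiE_iff extensional_def)
      ultimately show "g \<in> (\<lambda>f. restrict f (fixed \<union> S)) ` equivariant_maps" by blast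
    qed
  qed
  then have "card equivariant_maps = (\<Prod>r\<in>fixed \<union> S. card (B r))"
    using fin' by (simp add: bij_betw_same_card card_PiE)
  also have "\<dots> = (\<Prod>r\<in>fixed. card (B r)) * (\<Prod>r\<in>S. card (B r))"
    using fin' by (rule prod.union_disjoint)
  also have "(\<Prod>r\<in>fixed. card (B r)) = card fixed ^ card fixed" by (simp add: B_def)
  also have "(\<Prod>r\<in>S. card (B r)) = (\<Prod>r\<in>S. card (C - fixed))"
    using S(1) by (intro prod.cong) (auto simp: B_def)
  also have "\<dots> = card (C - fixed) ^ card S" by simp
  also have "card S = card (C - fixed) div p" using card_S \<open>p > 0\<close> by simp
  finally show ?thesis .
qed

end


section \<open>Finite fields and the Frobenius map\<close>

text \<open>Induction by Pascal's rule: multiplying the sum by \<open>x\<close> shifts the index by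
  one, multiplying it by \<open>y\<close> keeps the index.\<close>

lemma (in cring) binomial:
  assumes [simp]: "x \<in> carrier R" "y \<in> carrier R"
  shows "(x \<oplus> y) [^] n = (\<Oplus>i\<in>{..n}. [(n choose i)] \<cdot> (x [^] i \<otimes> y [^] (n - i)))"
proof (induction n)
  case (Suc n)
  define t where "t m i = [(m choose i)] \<cdot> (x [^] i \<otimes> y [^] (m - i))" for m i :: nat
  define u where "u i = [(n choose i)] \<cdot> (x [^] i \<otimes> y [^] (Suc n - i))" for i
  have [simp]: "t m i \<in> carrier R" "u i \<in> carrier R" for m i by (simp_all add: t_def u_def)
  have mult_x: "t n i \<otimes> x = [(n choose i)] \<cdot> (x [^] Suc i \<otimes> y [^] (Suc n - Suc i))" for i
    unfolding t_def by (simp add: add_pow_ldistr add_pow_rdistr m_ac)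
  have mult_y: "t n i \<otimes> y = u i" if "i \<le> n" for i
    using that unfolding t_def u_def by (simp add: add_pow_ldistr add_pow_rdistr Suc_diff_le m_ac)
  \<comment> \<open>This vanishing term extends the second sum to \<open>Suc n\<close>; splitting
    off index 0 then aligns it with the shifted first sum.\<close>
  have u_last: "u (Suc n) = \<zero>" by (simp add: u_def binomial_eq_0)
  have step: "t n i \<otimes> x \<oplus> u (Suc i) = t (Suc n) (Suc i)" for i
    unfolding mult_x by (simp add: u_def t_def add.nat_pow_mult)
  have "(x \<oplus> y) [^] Suc n = (\<Oplus>i\<in>{..n}. t n i) \<otimes> (x \<oplus> y)"
    using Suc by (simp add: t_def)
  also have "\<dots> = (\<Oplus>i\<in>{..n}. t n i \<otimes> x) \<oplus> (\<Oplus>i\<in>{..n}. t n i \<otimes> y)"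
    by (simp add: r_distr finsum_ldistr)
  also have "(\<Oplus>i\<in>{..n}. t n i \<otimes> y) = (\<Oplus>i\<in>{..n}. u i)"
    by (rule finsum_cong') (auto simp: mult_y)
  also have "\<dots> = (\<Oplus>i\<in>{..Suc n}. u i)"
    using finsum_Suc[of u n] by (simp add: u_last)
  also have "\<dots> = (\<Oplus>i\<in>{..n}. u (Suc i)) \<oplus> u 0"
    by (rule finsum_Suc2) simp
  also have "(\<Oplus>i\<in>{..n}. t n i \<otimes> x) \<oplus> \<dots> = (\<Oplus>i\<in>{..n}. t n i \<otimes> x \<oplus> u (Suc i)) \<oplus> u 0"
    by (simp add: finsum_addf a_assoc)
  also have "\<dots> = (\<Oplus>i\<in>{..n}. t (Suc n) (Suc i)) \<oplus> t (Suc n) 0"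
    by (simp add: step) (simp add: t_def u_def)
  also have "\<dots> = (\<Oplus>i\<in>{..Suc n}. t (Suc n) i)"
    by (rule finsum_Suc2[symmetric]) simp
  finally show ?case by (simp add: t_def)
qed simp

lemma (in cring) add_pow_char_multiple:
  fixes p n :: nat
  assumes "[p] \<cdot> \<one> = \<zero>" "p dvd n" "a \<in> carrier R"
  shows "[n] \<cdot> a = \<zero>"
proof -
  obtain k where n: "n = p * k" using assms(2) by blast
  have "[p] \<cdot> a = [p] \<cdot> \<one> \<otimes> a" using assms(3) by (simp add: add_pow_ldistr)
  also have "\<dots> = \<zero>" using assms(1,3) by simp
  finally show ?thesis
    using add.nat_pow_pow[OF assms(3), of k p] by (simp add: n)
qed

text \<open>The prime \<open>p\<close> divides every inner binomial coefficient, so only the two end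
  terms survive.\<close>

lemma (in cring) frobenius_add:
  fixes p :: nat
  assumes "Factorial_Ring.prime p" "[p] \<cdot> \<one> = \<zero>" and [simp]: "x \<in> carrier R" "y \<in> carrier R"
  shows "(x \<oplus> y) [^] p = x [^] p \<oplus> y [^] p"
proof -
  \<comment> \<open>In this form both end terms can be peeled off, leaving the indices
    \<open>Suc i\<close> with \<open>i \<le> r\<close>.\<close>
  obtain r where p: "p = Suc (Suc r)"
    using prime_ge_2_nat[OF assms(1)] by (metis Suc_le_D numeral_2_eq_2 Suc_le_mono)
  define t where "t i = [(p choose i)] \<cdot> (x [^] i \<otimes> y [^] (p - i))" for i
  have [simp]: "t i \<in> carrier R" for i by (simp add: t_def)
  have "t (Suc i) = \<zero>" if "i \<le> r" for i
  proof -
    have "p dvd (p choose Suc i)"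
      using that assms(1) p by (intro dvd_choose_prime) (auto simp del: binomial_Suc_Suc)
    then show ?thesis unfolding t_def by (intro add_pow_char_multiple[OF assms(2)]) auto
  qed
  then have middle: "(\<Oplus>i\<in>{..r}. t (Suc i)) = \<zero>"
    by (intro add.finprod_one_eqI) auto
  have "(x \<oplus> y) [^] p = (\<Oplus>i\<in>{..Suc (Suc r)}. t i)"
    using binomial[of x y p] by (simp add: t_def p)
  also have "\<dots> = t p \<oplus> (\<Oplus>i\<in>{..Suc r}. t i)" unfolding p by (rule finsum_Suc) simp
  also have "(\<Oplus>i\<in>{..Suc r}. t i) = t 0" using finsum_Suc2[of t r] middle by simp
  finally show ?thesis by (simp add: t_def)
qed

text \<open>Lagrange's theorem in the additive group kills the \<open>p ^ k\<close>-fold sum of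
  \<open>\<one>\<close>. That sum is the \<open>k\<close>-th power of the \<open>p\<close>-fold one,
  and a domain has no zero divisors.\<close>

lemma (in domain) char_of_prime_power_order:
  fixes p :: nat
  assumes "order R = p ^ k"
  shows "[p] \<cdot> \<one> = \<zero>"
proof -
  have "[(p ^ k)] \<cdot> \<one> = \<zero>"
    using add.pow_order_eq_1[of \<one>] assms by (simp add: order_def)
  then show ?thesis
  proof (induction k)
    case (Suc k)
    have "[(p ^ Suc k)] \<cdot> \<one> = [p] \<cdot> \<one> \<otimes> [(p ^ k)] \<cdot> \<one>"
      using add.nat_pow_pow[of \<one> p "p ^ k"] by (simp add: add_pow_ldistr mult.commute)
    then show ?case using Suc integral by fastforce
  qed simp
qed

section \<open>Power maps and their fixed points\<close>

lemma (in domain) nat_pow_nonzero: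
  assumes "x \<in> carrier R" "x \<noteq> \<zero>"
  shows "x [^] (n :: nat) \<noteq> \<zero>"
  using assms by (induction n) (auto simp: integral_iff)

text \<open>Lagrange's theorem in the multiplicative group, with zero treated separately.\<close>

lemma (in field) pow_order_eq_self:
  assumes "finite (carrier R)" "x \<in> carrier R"
  shows "x [^] order R = x"
proof -
  have pos: "order R > 0" using assms by (auto simp: order_def card_gt_0_iff)
  show ?thesis
  proof (cases "x = \<zero>")
    case True
    then show ?thesis using pos by (simp add: nat_pow_zero)
  next
    case False
    then have "x [^] (order R - 1) = \<one>"
      using group.pow_order_eq_1[OF field_mult_group, of x] assms
      by (simp add: order_mult_of Multiplicative_Group.nat_pow_mult_of)
    moreover have "x [^] order R = x [^] (order R - 1) \<otimes> x"
      using pos by (metis Suc_diff_1 nat_pow_Suc)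
    ultimately show ?thesis using assms by simp
  qed
qed

text \<open>This places every subfield with \<open>p\<close> elements inside the Frobenius fixed
  points.\<close>

lemma (in field) subfield_pow_card:
  assumes "subfield L R" "finite L" "x \<in> L"
  shows "x [^] card L = x"
  using field.pow_order_eq_self[OF subfield_iff(2)[OF assms(1)], of x] assms(2,3)
  by (simp add: order_def flip: nat_pow_consistent)

text \<open>Apart from zero, the solutions are roots of unity of exponent \<open>n - 1\<close>, of
  which there are at most \<open>n - 1\<close>.\<close>

lemma (in domain) card_pow_fixed_le:
  fixes n :: nat
  assumes "finite (carrier R)" "n \<ge> 2"
  shows "card {x \<in> carrier R. x [^] n = x} \<le> n"
proof -
  define A where "A = {x \<in> carrier R. x [^] (n - 1) = \<one>}"
  have "{x \<in> carrier R. x [^] n = x} \<subseteq> insert \<zero> A"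
  proof clarify
    fix x assume x: "x \<in> carrier R" "x [^] n = x" "x \<notin> A"
    have "x [^] (n - 1) \<otimes> x = \<one> \<otimes> x"
      using x(1,2) assms(2) nat_pow_Suc[of x "n - 1"] by simp
    then show "x = \<zero>" using x m_rcancel[of x "x [^] (n - 1)" \<one>] by (auto simp: A_def)
  qed
  then have "card {x \<in> carrier R. x [^] n = x} \<le> card (insert \<zero> A)"
    using assms(1) by (intro card_mono) (auto simp: A_def)
  also have "\<dots> \<le> Suc (card A)" by (rule card_insert_le_m1) auto
  also have "card A \<le> n - 1" unfolding A_def using assms by (intro num_roots_le_deg) auto
  finally show ?thesis using assms(2) by simp
qed

section \<open>Polynomial functions on a finite field\<close>

text \<open>The difference vanishes on the whole field, which is more roots than its degree permits
  for a nonzero polynomial.\<close>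

lemma (in field) poly_eqI_eval:
  assumes "finite (carrier R)"
    and P: "P \<in> carrier (poly_ring R)" "degree P < order R"
    and Q: "Q \<in> carrier (poly_ring R)" "degree Q < order R"
    and eq: "\<And>x. x \<in> carrier R \<Longrightarrow> eval P x = eval Q x"
  shows "P = Q"
proof -
  interpret UP: domain "poly_ring R" using univ_poly_is_domain[OF carrier_is_subring] .
  define D where "D = P \<ominus>\<^bsub>poly_ring R\<^esub> Q"
  have D: "D \<in> carrier (poly_ring R)" using P Q by (simp add: D_def)
  have "degree D \<le> max (degree P) (degree Q)"
    unfolding D_def a_minus_def univ_poly_add
    using poly_add_degree[of P "\<ominus>\<^bsub>poly_ring R\<^esub> Q"]
      univ_poly_a_inv_degree[OF carrier_is_subring Q(1)] by simp
  then have deg: "degree D < order R" using P Q by simp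
  have root: "eval D x = \<zero>" if x: "x \<in> carrier R" for x
  proof -
    interpret h: ring_hom_ring "poly_ring R" R "\<lambda>P. eval P x"
      using eval_ring_hom[OF carrier_is_subring x] .
    show ?thesis
      using eq[OF x] P Q x h.hom_closed[of Q] unfolding D_def a_minus_def by (simp add: r_neg)
  qed
  have "D = []"
  proof (rule ccontr)
    assume "D \<noteq> []"
    then have "carrier R \<subseteq> set_mset (roots D)"
      using roots_mem_iff_is_root[OF D] root by (auto simp: is_root_def)
    then have "order R \<le> card (set_mset (roots D))"
      unfolding order_def by (intro card_mono) auto
    also have "\<dots> \<le> size (roots D)"
      using size_mset_mono[OF mset_set_set_mset_msubset, of "roots D"] by simp
    also have "\<dots> \<le> degree D" using size_roots_le_degree[OF D] .
    finally show False using deg by simp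
  qed
  then have "D = \<zero>\<^bsub>poly_ring R\<^esub>" by (simp add: univ_poly_zero)
  then show ?thesis using P Q unfolding D_def by simp
qed

text \<open>Counting replaces an explicit formula: evaluation is injective on coefficient lists of
  length \<open>order R\<close>, and there are as many such lists as self-maps of the field.\<close>

lemma (in field) interpolation:
  assumes fin: "finite (carrier R)" and f: "f \<in> carrier R \<rightarrow> carrier R"
  obtains P where "P \<in> carrier (poly_ring R)" "degree P < order R"
    "\<And>x. x \<in> carrier R \<Longrightarrow> eval P x = f x"
proof -
  \<comment> \<open>Leading zeros are allowed here, which makes the lists easy to count;
    \<open>normalize\<close> strips them to obtain actual polynomials.\<close>
  define A where "A = {l. set l \<subseteq> carrier R \<and> length l = order R}"
  have pos: "order R > 0" using fin by (auto simp: order_def card_gt_0_iff)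
  have norm: "normalize l \<in> carrier (poly_ring R)" "degree (normalize l) < order R" if "l \<in> A" for l
    using that normalize_gives_polynomial[of l "carrier R"] normalize_length_le[of l] pos
    by (auto simp: A_def univ_poly_carrier)
  have ev: "eval (normalize l) x = eval l x" if "l \<in> A" "x \<in> carrier R" for l x
    using that by (intro eval_normalize) (auto simp: A_def)
  define E where "E l = restrict (eval l) (carrier R)" for l
  have "inj_on E A"
  proof (rule inj_onI)
    fix l m assume lm: "l \<in> A" "m \<in> A" "E l = E m"
    then have "eval l x = eval m x" if "x \<in> carrier R" for x
      using that unfolding E_def by (metis restrict_apply')
    then have "normalize l = normalize m"
      using lm by (intro poly_eqI_eval[OF fin norm norm]) (auto simp: ev)
    \<comment> \<open>A list of known length is recovered from its normal form by padding with
      zeros.\<close>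
    then show "l = m"
      using lm normalize_trick[of l] normalize_trick[of m] by (simp add: A_def)
  qed
  then have "card (E ` A) = order R ^ order R"
    unfolding A_def by (simp add: card_image card_lists_length_eq fin order_def)
  also have "\<dots> = card (carrier R \<rightarrow>\<^sub>E carrier R)"
    using fin by (simp add: card_PiE order_def)
  finally have "card (E ` A) = card (carrier R \<rightarrow>\<^sub>E carrier R)" .
  moreover have "E ` A \<subseteq> carrier R \<rightarrow>\<^sub>E carrier R"
    by (auto simp: E_def A_def intro!: eval_in_carrier)
  ultimately have "E ` A = carrier R \<rightarrow>\<^sub>E carrier R"
    using fin by (intro card_subset_eq finite_PiE) auto
  moreover have "restrict f (carrier R) \<in> carrier R \<rightarrow>\<^sub>E carrier R" using f by auto
  ultimately obtain l where l: "l \<in> A" "restrict f (carrier R) = E l" by blast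
  have "eval (normalize l) x = f x" if "x \<in> carrier R" for x
    using ev[OF l(1) that] l(2) that unfolding E_def by (metis restrict_apply')
  then show thesis using that norm[OF l(1)] by blast
qed

text \<open>Interpolation gives existence and \<open>poly_eqI_eval\<close> uniqueness, so the
  definite description denotes.\<close>

lemma (in field) polynomial_representation:
  assumes "finite (carrier R)" "f \<in> carrier R \<rightarrow> carrier R"
  shows "polynomial_representation R f \<in> carrier (poly_ring R)"
    and "degree (polynomial_representation R f) < order R"
    and "x \<in> carrier R \<Longrightarrow> eval (polynomial_representation R f) x = f x"
proof -
  obtain P where P: "P \<in> carrier (poly_ring R)" "degree P < order R"
    "\<And>x. x \<in> carrier R \<Longrightarrow> eval P x = f x"
    using interpolation[OF assms] by blast
  have "polynomial_representation R f = P"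
    unfolding polynomial_representation_def
    by (rule the_equality) (use P poly_eqI_eval[OF assms(1)] in auto)
  with P show "polynomial_representation R f \<in> carrier (poly_ring R)"
    "degree (polynomial_representation R f) < order R"
    "x \<in> carrier R \<Longrightarrow> eval (polynomial_representation R f) x = f x" by auto
qed

section \<open>The field with \<open>p ^ p\<close> elements\<close>

locale field_order_prime_self_power = field R for R (structure) +
  fixes p :: nat
  assumes p_prime: "Factorial_Ring.prime p" and order_eq: "order R = p ^ p"
begin

lemma p_ge_2: "p \<ge> 2" using p_prime by (rule prime_ge_2_nat)

lemma p_power_self: "p ^ p = p * p ^ (p - 1)"
  using p_ge_2 power_Suc[of p "p - 1"] by simp

lemma finite_carrier: "finite (carrier R)"
proof -
  have "order R > 0" using order_eq p_ge_2 by simp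
  then show ?thesis by (simp add: order_def card_gt_0_iff)
qed

lemma frobenius_funpow: "x \<in> carrier R \<Longrightarrow> ((\<lambda>x. x [^] p) ^^ n) x = x [^] (p ^ n)"
  by (induction n) (auto simp: nat_pow_pow mult.commute)

text \<open>The \<open>p\<close>-th Frobenius iterate raises to the power \<open>p ^ p\<close>, the
  order of the field, and is therefore the identity.\<close>

sublocale frob: prime_period "carrier R" "\<lambda>x. x [^] p" p
  using finite_carrier p_prime pow_order_eq_self[OF finite_carrier]
  by unfold_locales (auto simp: frobenius_funpow order_eq)

lemma frobenius_hom: "ring_hom_ring R R (\<lambda>x. x [^] p)"
  by (intro ring_hom_ringI2 ring_axioms ring_hom_memI)
    (auto simp: nat_pow_distrib frobenius_add[OF p_prime char_of_prime_power_order[OF order_eq]])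

text \<open>At most \<open>p\<close> elements satisfy \<open>x [^] p = x\<close>. Conversely their
  number is a multiple of \<open>p\<close>, and it is positive because \<open>\<one>\<close> is
  among them.\<close>

lemma card_fixed: "card frob.fixed = p"
proof (rule antisym)
  show "card frob.fixed \<le> p"
    unfolding frob.fixed_def using finite_carrier p_ge_2 by (rule card_pow_fixed_le)
  have "p dvd card (carrier R)" using order_eq p_ge_2 by (simp add: order_def)
  then have "p dvd card frob.fixed" by (rule frob.card_fixed_dvd)
  moreover have "card frob.fixed > 0"
    using finite_carrier p_ge_2 by (auto simp: frob.fixed_def card_gt_0_iff intro!: exI[of _ \<one>])
  ultimately show "p \<le> card frob.fixed" by (rule dvd_imp_le)
qed

lemma subfield_fixed: "subfield frob.fixed R"
proof -
  interpret h: ring_hom_ring R R "\<lambda>x. x [^] p" by (rule frobenius_hom)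
  show ?thesis
  proof (rule subfieldI')
    show "subring frob.fixed R"
      by (rule subringI) (auto simp: frob.fixed_def nat_pow_distrib)
    fix k assume "k \<in> frob.fixed - {\<zero>}"
    then have k: "k \<in> Units R" "k [^] p = k" by (auto simp: frob.fixed_def field_Units)
    \<comment> \<open>As \<open>k [^] p = k\<close>, the \<open>p\<close>-th power of
      \<open>inv k\<close> is again an inverse of \<open>k\<close>.\<close>
    then have "k \<otimes> inv k [^] p = (k \<otimes> inv k) [^] p"
      by (metis nat_pow_distrib Units_closed Units_inv_closed)
    also have "\<dots> = \<one>" using k by simp
    finally have "inv k = inv k [^] p" using k by (intro comm_inv_char) auto
    then show "inv k \<in> frob.fixed" using k by (simp add: frob.fixed_def)
  qed
qed

text \<open>Any subfield with \<open>p\<close> elements lies in \<open>frob.fixed\<close> and has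
  the same cardinality, which settles uniqueness.\<close>

lemma subfield_of_order_p: "subfield_of_order R p = frob.fixed"
  unfolding subfield_of_order_def
proof (rule the_equality)
  show "subfield frob.fixed R \<and> card frob.fixed = p"
    using subfield_fixed card_fixed by simp
  fix L assume L: "subfield L R \<and> card L = p"
  \<comment> \<open>An infinite set has \<open>card\<close> 0, which differs from
    \<open>p\<close>.\<close>
  then have "finite L" using p_ge_2 by (metis card.infinite not_numeral_le_zero)
  have "L \<subseteq> frob.fixed"
  proof
    fix x assume x: "x \<in> L"
    then have "x \<in> carrier R" using L subfieldE(3) by blast
    then show "x \<in> frob.fixed"
      using subfield_pow_card[of L x] L \<open>finite L\<close> x by (simp add: frob.fixed_def)
  qed
  then show "L = frob.fixed"
    using L card_fixed finite_carrier by (intro card_subset_eq) (auto simp: frob.fixed_def)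
qed

lemma subfield_of_order_full: "subfield_of_order R (p ^ p) = carrier R"
  unfolding subfield_of_order_def
proof (rule the_equality)
  show "subfield (carrier R) R \<and> card (carrier R) = p ^ p"
    using carrier_is_subfield order_eq by (simp add: order_def)
  fix L assume "subfield L R \<and> card L = p ^ p"
  then show "L = carrier R"
    using subfieldE(3)[of L R] finite_carrier order_eq
    by (intro card_subset_eq) (auto simp: order_def)
qed

text \<open>The divisors of \<open>p\<close> are 1 and \<open>p\<close>. Of the four pairs
  \<open>(d, s)\<close> only \<open>d = p\<close>, \<open>s = 1\<close> gives a set difference that
  is not trivially empty.\<close>

lemma subfield_preserving_iff:
  assumes "f \<in> carrier R \<rightarrow> carrier R"
  shows "subfield_preserving R p p f \<longleftrightarrow>
    f ` frob.fixed \<subseteq> frob.fixed \<and> f ` (carrier R - frob.fixed) \<subseteq> carrier R - frob.fixed"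
proof -
  have div: "0 < d \<and> d dvd p \<longleftrightarrow> d = 1 \<or> d = p" for d
    using p_prime p_ge_2 by (auto simp: prime_nat_iff)
  have "subfield_preserving R p p f \<longleftrightarrow> f ` frob.fixed \<subseteq> frob.fixed \<and>
     (\<forall>d s. (d = 1 \<or> d = p) \<and> (s = 1 \<or> s = p) \<longrightarrow>
        f ` (subfield_of_order R (p ^ d) - subfield_of_order R (p ^ s))
          \<subseteq> subfield_of_order R (p ^ d) - subfield_of_order R (p ^ s))"
    unfolding subfield_preserving_def subfield_of_order_p using div by metis
  also have "\<dots> \<longleftrightarrow> f ` frob.fixed \<subseteq> frob.fixed \<and>
      f ` (carrier R - frob.fixed) \<subseteq> carrier R - frob.fixed"
  proof -
    have "frob.fixed - carrier R = {}" by (auto simp: frob.fixed_def)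
    then show ?thesis
      by (metis (no_types, lifting) Diff_cancel image_empty order_refl power_one_right
          subfield_of_order_full subfield_of_order_p)
  qed
  finally show ?thesis .
qed

text \<open>Raising the coefficients of \<open>P\<close> to the \<open>p\<close>-th power gives
  \<open>Q\<close> with \<open>Q(x^p) = P(x)^p\<close>. The coefficients are fixed iff
  \<open>Q = P\<close>, and by uniqueness this can be tested on values.\<close>

lemma coeffs_fixed_iff_equivariant:
  assumes f: "f \<in> carrier R \<rightarrow> carrier R"
  shows "set (polynomial_representation R f) \<subseteq> frob.fixed \<longleftrightarrow>
    (\<forall>x\<in>carrier R. f (x [^] p) = f x [^] p)"
proof -
  interpret h: ring_hom_ring R R "\<lambda>x. x [^] p" by (rule frobenius_hom)
  define P where "P = polynomial_representation R f"
  have P: "P \<in> carrier (poly_ring R)" "degree P < order R"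
    and ev: "\<And>x. x \<in> carrier R \<Longrightarrow> eval P x = f x"
    using polynomial_representation[OF finite_carrier f] by (auto simp: P_def)
  have P_coeffs: "set P \<subseteq> carrier R"
    using P(1) by (auto simp: polynomial_def simp flip: univ_poly_carrier)
  define Q where "Q = map (\<lambda>x. x [^] p) P"
  have ev_Q: "eval Q (x [^] p) = f x [^] p" if "x \<in> carrier R" for x
    using h.eval_hom'[OF that P_coeffs] ev[OF that] by (simp add: Q_def)
  have Q: "Q \<in> carrier (poly_ring R)" "degree Q < order R"
  proof -
    \<comment> \<open>Frobenius keeps the leading coefficient nonzero, so the coefficient list
      \<open>Q\<close> is already normalized.\<close>
    have "lead_coeff Q \<noteq> \<zero>" if "P \<noteq> []"
    proof -
      have "lead_coeff P \<in> carrier R" "lead_coeff P \<noteq> \<zero>"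
        using P(1) P_coeffs that by (auto simp: polynomial_def simp flip: univ_poly_carrier)
      then show ?thesis using that nat_pow_nonzero by (simp add: Q_def hd_map)
    qed
    then show "Q \<in> carrier (poly_ring R)"
      using P_coeffs by (auto simp: Q_def polynomial_def simp flip: univ_poly_carrier)
    show "degree Q < order R" using P(2) by (simp add: Q_def)
  qed
  \<comment> \<open>\<open>ev_Q\<close> describes \<open>Q\<close> only at \<open>p\<close>-th
    powers; since \<open>x [^] (p ^ p) = x\<close>, the power \<open>x [^] (p ^ (p - 1))\<close> is
    a \<open>p\<close>-th root of \<open>x\<close>.\<close>
  have surj: "\<exists>y\<in>carrier R. x = y [^] p" if "x \<in> carrier R" for x
  proof -
    have "x = (x [^] (p ^ (p - 1))) [^] p"
      using that pow_order_eq_self[OF finite_carrier that]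
      unfolding order_eq p_power_self by (simp add: nat_pow_pow mult.commute)
    then show ?thesis using that by blast
  qed
  have "set P \<subseteq> frob.fixed \<longleftrightarrow> (\<forall>x\<in>set P. x [^] p = x)"
    using P_coeffs by (auto simp: frob.fixed_def)
  also have "\<dots> \<longleftrightarrow> Q = P"
    using map_eq_conv[of "\<lambda>x. x [^] p" P "\<lambda>x. x"] by (simp add: Q_def)
  also have "\<dots> \<longleftrightarrow> (\<forall>x\<in>carrier R. f (x [^] p) = f x [^] p)"
  proof
    assume "Q = P"
    then show "\<forall>x\<in>carrier R. f (x [^] p) = f x [^] p" using ev_Q ev by simp
  next
    assume eqv: "\<forall>x\<in>carrier R. f (x [^] p) = f x [^] p"
    show "Q = P"
    proof (rule poly_eqI_eval[OF finite_carrier Q P])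
      fix x assume "x \<in> carrier R"
      then obtain y where "y \<in> carrier R" "x = y [^] p" using surj by blast
      then show "eval Q x = eval P x" using ev_Q ev eqv by simp
    qed
  qed
  finally show ?thesis by (simp add: P_def)
qed

lemma card_T: "card (T R p p) = p ^ p * (p ^ p - p) ^ (p ^ (p - 1) - 1)"
proof -
  have "f \<in> T R p p \<longleftrightarrow> f \<in> frob.equivariant_maps" for f
  proof (cases "f \<in> carrier R \<rightarrow>\<^sub>E carrier R")
    case True
    then have f: "f \<in> carrier R \<rightarrow> carrier R" by (simp add: PiE_def)
    show ?thesis
      unfolding T_def frob.equivariant_maps_def subfield_of_order_p mem_Collect_eq
        subfield_preserving_iff[OF f] coeffs_fixed_iff_equivariant[OF f]
      by (simp only: conj_ac)
  qed (simp add: T_def frob.equivariant_maps_def)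
  then have "T R p p = frob.equivariant_maps" by blast
  moreover have "card (carrier R - frob.fixed) = p ^ p - p"
    using card_fixed finite_carrier order_eq
    by (subst card_Diff_subset) (auto simp: frob.fixed_def order_def)
  moreover have "(p ^ p - p) div p = p ^ (p - 1) - 1"
  proof -
    have "p ^ p - p = p * (p ^ (p - 1) - 1)"
      unfolding p_power_self by (simp add: diff_mult_distrib2)
    then show ?thesis using p_ge_2 by simp
  qed
  ultimately show ?thesis using frob.card_equivariant_maps card_fixed by simp
qed

end


section \<open>Asymptotics\<close>

text \<open>The exponent \<open>n - 1\<close> differs from the classical \<open>n\<close> by one
  factor \<open>1 - 1 / n\<close>, which tends to 1.\<close>

lemma tendsto_one_minus_inverse_power:
  "(\<lambda>n. (1 - 1 / real n) ^ (n - 1)) \<longlonglongrightarrow> 1 / exp 1"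
proof -
  have "(\<lambda>n. (1 + (-1) / real n) ^ n / (1 - 1 / real n)) \<longlonglongrightarrow> exp (-1) / (1 - 0)"
    by (intro tendsto_intros tendsto_exp_limit_sequentially lim_1_over_n) auto
  then have "(\<lambda>n. (1 + (-1) / real n) ^ n / (1 - 1 / real n)) \<longlonglongrightarrow> 1 / exp 1"
    by (simp add: exp_minus field_simps)
  moreover have "\<forall>\<^sub>F n in sequentially.
      (1 + (-1) / real n) ^ n / (1 - 1 / real n) = (1 - 1 / real n) ^ (n - 1)"
    \<comment> \<open>For \<open>n > 1\<close> the divisor \<open>1 - 1 / real n\<close> is
      nonzero.\<close>
    using eventually_gt_at_top[of 1]
  proof eventually_elim
    case (elim n)
    then have "n = Suc (n - 1)" by simp
    then have "(1 - 1 / real n) ^ n = (1 - 1 / real n) * (1 - 1 / real n) ^ (n - 1)"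
      by (metis power_Suc)
    then show ?case using elim by simp
  qed
  ultimately show ?thesis by (rule Lim_transform_eventually)
qed

text \<open>The limit is taken along all natural numbers: the closed formula makes sense for
  composite \<open>p\<close> too.\<close>

lemma tendsto_count_ratio:
  "(\<lambda>p. real (p ^ p * (p ^ p - p) ^ (p ^ (p - 1) - 1)) / real (p ^ (p ^ p))) \<longlonglongrightarrow> 1 / exp 1"
proof -
  have "filterlim (\<lambda>p::nat. p ^ (p - 1)) at_top sequentially"
  proof (rule filterlim_at_top_mono[OF filterlim_ident])
    show "\<forall>\<^sub>F p::nat in sequentially. p \<le> p ^ (p - 1)"
      using eventually_ge_at_top[of 2] by eventually_elim (auto intro: self_le_power)
  qed
  from filterlim_compose[OF tendsto_one_minus_inverse_power this]
  have "(\<lambda>p. (1 - 1 / real (p ^ (p - 1))) ^ (p ^ (p - 1) - 1)) \<longlonglongrightarrow> 1 / exp 1" .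
  moreover have "\<forall>\<^sub>F p in sequentially. (1 - 1 / real (p ^ (p - 1))) ^ (p ^ (p - 1) - 1)
      = real (p ^ p * (p ^ p - p) ^ (p ^ (p - 1) - 1)) / real (p ^ (p ^ p))"
    using eventually_ge_at_top[of 2]
  proof eventually_elim
    case (elim p)
    define n where "n = p ^ (p - 1)"
    \<comment> \<open>With this \<open>n\<close>, the denominator becomes \<open>(p * n) ^ n\<close>
      and the numerator \<open>p * n * (p * n - p) ^ (n - 1)\<close>; cancelling the powers of
      \<open>p * n\<close> leaves \<open>(1 - 1 / n) ^ (n - 1)\<close>.\<close>
    have pp: "p ^ p = p * n" using elim by (simp add: n_def power_eq_if)
    have "n \<ge> 1" using elim by (simp add: n_def)
    have "p ^ (p ^ p) = (p * n) ^ n" by (metis pp power_mult)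
    also have "\<dots> = (p * n) * (p * n) ^ (n - 1)" using \<open>n \<ge> 1\<close> by (simp add: power_eq_if)
    finally have den: "real (p ^ (p ^ p)) = real (p * n) * real (p * n) ^ (n - 1)"
      by (metis of_nat_mult of_nat_power)
    have "real (p * n - p) = real (p * n) * (1 - 1 / real n)"
      using \<open>n \<ge> 1\<close> by (simp add: of_nat_diff field_simps)
    then have "real (p ^ p * (p ^ p - p) ^ (n - 1))
        = real (p * n) * real (p * n) ^ (n - 1) * (1 - 1 / real n) ^ (n - 1)"
      unfolding pp of_nat_mult[of "p * n"] of_nat_power by (simp add: power_mult_distrib)
    then have "real (p ^ p * (p ^ p - p) ^ (n - 1)) / real (p ^ (p ^ p)) = (1 - 1 / real n) ^ (n - 1)"
      unfolding den using elim \<open>n \<ge> 1\<close> by simp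
    then show ?case by (simp add: n_def)
  qed
  ultimately show ?thesis by (rule Lim_transform_eventually)
qed

text \<open>The filter is \<open>at_top\<close> restricted to the primes. On primes the cardinality
  equals the closed formula for any choice of the fields \<open>F p\<close>, and the limit along all
  naturals passes to the finer filter.\<close>

theorem corollary22:
  fixes F :: "nat \<Rightarrow> ('a, 'b) ring_scheme"
  assumes "\<And>p. Factorial_Ring.prime p \<Longrightarrow> field (F p)"
    and "\<And>p. Factorial_Ring.prime p \<Longrightarrow> order (F p) = p ^ p"
  shows "((\<lambda>p. real (card (T (F p) p p)) / real (p ^ (p ^ p))) \<longlongrightarrow> 1 / exp 1)
           (inf at_top (principal {p. Factorial_Ring.prime p}))"
proof (rule Lim_transform_eventually)
  show "((\<lambda>p. real (p ^ p * (p ^ p - p) ^ (p ^ (p - 1) - 1)) / real (p ^ (p ^ p)))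
      \<longlongrightarrow> 1 / exp 1) (inf at_top (principal {p. Factorial_Ring.prime p}))"
    using tendsto_count_ratio by (rule tendsto_mono[rotated]) simp
  have "card (T (F p) p p) = p ^ p * (p ^ p - p) ^ (p ^ (p - 1) - 1)"
    if "Factorial_Ring.prime p" for p
    using assms that
    by (intro field_order_prime_self_power.card_T field_order_prime_self_power.intro
        field_order_prime_self_power_axioms.intro)
  then show "\<forall>\<^sub>F p in inf at_top (principal {p. Factorial_Ring.prime p}).
      real (p ^ p * (p ^ p - p) ^ (p ^ (p - 1) - 1)) / real (p ^ (p ^ p))
      = real (card (T (F p) p p)) / real (p ^ (p ^ p))"
    by (simp add: eventually_inf_principal)
qed

end
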